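(* Let $b\geq 3$ be an integer, and let $\alpha$ and $\beta$ be integers with $\alpha\beta\neq 0$. Further, let $q\geq 5$ be a prime, and let $\mathcal{C}$ be a $b$-primitive covering system with moduli $m_{(j,\overline{j},j')}=2^j3^{\overline{j}}q^{j'}$ for $0\leq j\leq q$, $1\leq\overline{j}\leq q$, and $0\leq j'\leq 1$ (one congruence for each such modulus). Lastly, let $M=\operatorname{lcm}\left(\{2^q,\,3^q,\,b-1,\,q\}\cup\mathcal{P}_b(\mathcal{C})\right)$. Then there exists an integer $T$ such that for all nonnegative integers $t\equiv T\pmod{M}$ with $(tb^t+\alpha)b+\beta\geq\max\mathcal{P}_b(\mathcal{C})$, we have $\gcd(tb^t+\alpha+\beta,\,b-1)=1$, and the expression $(tb^t+\alpha)b^n+\beta$ is composite for all positive integers $n$.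
   Context: A covering system (of the integers) is a finite collection of congruences $r_i\pmod{m_i}$, $1\le i\le \nu$, such that every integer $n$ satisfies $n\equiv r_i\pmod{m_i}$ for at least one $i$. For integers $b\geq 2$ and $w\geq 1$, a prime $p$ is a primitive prime divisor of $b^w-1$ if $p\mid b^w-1$ and $p\nmid b^\ell-1$ for all $1\leq \ell<w$. A covering system $\mathcal{C}=\{r_i\pmod{m_i}:1\leq i\leq\nu\}$ is called $b$-primitive if there exist distinct primes $p_1,\ldots,p_\nu$ such that, for each $1\leq i\leq\nu$, $p_i$ is a primitive prime divisor of $b^{m_i}-1$. For a given $b$-primitive covering system $\mathcal{C}$, $\mathcal{P}_b(\mathcal{C})=\{p_1,\ldots,p_\nu\}$ denotes a (fixed, arbitrary) choice of such primes. *)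

theory Defs
  imports "HOL-Number_Theory.Number_Theory"
begin

definition covering_system :: "'i set \<Rightarrow> ('i \<Rightarrow> int) \<Rightarrow> ('i \<Rightarrow> nat) \<Rightarrow> bool" where
  "covering_system I r m \<longleftrightarrow>
     finite I \<and> (\<forall>i\<in>I. 1 \<le> m i) \<and> (\<forall>n::int. \<exists>i\<in>I. [n = r i] (mod int (m i)))"

definition primitive_prime_divisor :: "int \<Rightarrow> nat \<Rightarrow> int \<Rightarrow> bool" where
  "primitive_prime_divisor b w p \<longleftrightarrow>
     prime p \<and> p dvd b ^ w - 1 \<and> (\<forall>l. 1 \<le> l \<and> l < w \<longrightarrow> \<not> p dvd b ^ l - 1)"

definition primitive_prime_choice :: "int \<Rightarrow> 'i set \<Rightarrow> ('i \<Rightarrow> nat) \<Rightarrow> ('i \<Rightarrow> int) \<Rightarrow> bool" where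
  "primitive_prime_choice b I m p \<longleftrightarrow>
     inj_on p I \<and> (\<forall>i\<in>I. primitive_prime_divisor b (m i) (p i))"

definition primitive_covering_system ::
    "int \<Rightarrow> 'i set \<Rightarrow> ('i \<Rightarrow> int) \<Rightarrow> ('i \<Rightarrow> nat) \<Rightarrow> bool" where
  "primitive_covering_system b I r m \<longleftrightarrow>
     covering_system I r m \<and> (\<exists>p. primitive_prime_choice b I m p)"

(* Compositeness is understood up to sign: a negative integer is composite iff its absolute
   value is. The numbers 0, 1 and -1 are not composite. *)
definition composite_int :: "int \<Rightarrow> bool" where
  "composite_int N \<longleftrightarrow> \<bar>N\<bar> > 1 \<and> \<not> prime \<bar>N\<bar>"

end

theory Submission
  imports Defs
begin

text \<open>
  Choosing \<open>t b^t\<close> suitably modulo each of the primes \<open>p_i\<close> makes one of them divide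
  \<open>A_n = (t b^t + \<alpha>) b^n + \<beta>\<close> for every \<open>n\<close>. The only obstruction to compositeness is that
  \<open>A_n\<close> is \<open>0\<close> or \<open>\<plusminus>p_i\<close>, and this can indeed happen for isolated \<open>t\<close>, notably when
  \<open>t b^t + \<alpha> < 0\<close>. For all admissible \<open>t\<close> the values \<open>t b^t\<close> are congruent modulo every
  \<open>p_i\<close>, hence far apart, and a growth argument leaves at most two exceptional \<open>t\<close>. There are three
  admissible residue classes modulo \<open>M\<close>, so one of them contains no exceptional \<open>t\<close>.
\<close>

section \<open>Periodicity of powers and primitive prime divisors\<close>

lemma power_cong_of_exponent_cong:
  fixes b p :: int
  assumes "[b ^ k = 1] (mod p)" and "[int s = int t] (mod int k)"
  shows "[b ^ s = b ^ t] (mod p)"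
proof -
  have "[s = t] (mod k)"
    using assms(2) by (simp add: cong_int_iff)
  then obtain k1 k2 where k: "t + k1 * k = s + k2 * k"
    unfolding cong_iff_lin_nat by blast
  have one: "[b ^ (j * k) = 1] (mod p)" for j
    using cong_pow[OF assms(1), of j] by (simp add: power_mult[symmetric] mult.commute)
  have "[b ^ s * 1 = b ^ s * b ^ (k2 * k)] (mod p)"
    by (intro cong_mult cong_refl cong_sym[OF one])
  also have "b ^ s * b ^ (k2 * k) = b ^ t * b ^ (k1 * k)"
    using k by (metis power_add)
  also have "[b ^ t * b ^ (k1 * k) = b ^ t * 1] (mod p)"
    by (intro cong_mult cong_refl one)
  finally show ?thesis by simp
qed

lemma primitive_prime_divisor_coprime:
  assumes "primitive_prime_divisor b w p" and "w \<ge> 1"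
  shows "coprime b p"
proof -
  have p: "prime p" "p dvd b ^ w - 1"
    using assms by (auto simp: primitive_prime_divisor_def)
  have "\<not> p dvd b"
  proof
    assume "p dvd b"
    then have "p dvd b ^ w"
      using assms(2) by (simp add: dvd_power dvd_trans)
    then have "p dvd 1"
      using p(2) by (metis dvd_diff_right_iff)
    then show False
      using p(1) by (simp add: not_prime_unit)
  qed
  then show ?thesis
    using p(1) by (metis prime_imp_coprime coprime_commute)
qed

text \<open>By Fermat's little theorem \<open>p\<close> divides b^(p-1) - 1, which primitivity
  forbids if p - 1 < w.\<close>

lemma primitive_prime_divisor_gt:
  assumes "primitive_prime_divisor b w p" and "w \<ge> 1"
  shows "int w < p"
proof (rule ccontr)
  assume "\<not> int w < p"
  have p: "prime p" and min: "\<And>l. 1 \<le> l \<Longrightarrow> l < w \<Longrightarrow> \<not> p dvd b ^ l - 1"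
    using assms by (auto simp: primitive_prime_divisor_def)
  define P where "P = nat p"
  have P: "prime P" "p = int P"
    using p prime_gt_0_int[OF p] by (auto simp: P_def)
  \<comment> \<open>Fermat's theorem is applied over the naturals, so \<open>b\<close> is replaced
    by its nonnegative residue.\<close>
  define B where "B = nat (b mod p)"
  have B: "int B = b mod p"
    using prime_gt_0_int[OF p] by (simp add: B_def)
  have "coprime (int B) p"
    using primitive_prime_divisor_coprime[OF assms] prime_gt_0_int[OF p] by (simp add: B)
  then have "\<not> P dvd B"
    using P by (metis coprime_common_divisor dvd_refl int_dvd_int_iff not_prime_unit p)
  then have "[B ^ (P - 1) = 1] (mod P)"
    using P fermat_theorem by blast
  then have "[int B ^ (P - 1) = 1] (mod p)"
    unfolding P by (metis cong_int_iff of_nat_1 of_nat_power)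
  then have "[b ^ (P - 1) = 1] (mod p)"
    unfolding B by (simp add: cong_def power_mod)
  then have "p dvd b ^ (P - 1) - 1"
    by (simp add: cong_iff_dvd_diff)
  moreover have "1 \<le> P - 1" "P - 1 < w"
    using prime_ge_2_nat[OF P(1)] \<open>\<not> int w < p\<close> P(2) by linarith+
  ultimately show False
    using min by blast
qed

text \<open>The distinguished modulus \<open>N\<close> carries the induction: each new modulus is
  merged into it. Residues are indexed by the moduli themselves.\<close>

lemma chinese_remainder_int:
  fixes c :: "int \<Rightarrow> int"
  assumes "finite S" and "\<And>x. x \<in> S \<Longrightarrow> coprime N x"
    and "\<And>x y. x \<in> S \<Longrightarrow> y \<in> S \<Longrightarrow> x \<noteq> y \<Longrightarrow> coprime x y"
  shows "\<exists>z. [z = a] (mod N) \<and> (\<forall>x\<in>S. [z = c x] (mod x))"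
  using assms
proof (induction S arbitrary: N a rule: finite_induct)
  case empty
  then show ?case by (auto intro: cong_refl)
next
  case (insert x S)
  obtain z0 where z0: "[z0 = a] (mod N)" "[z0 = c x] (mod x)"
    using binary_chinese_remainder_int[of N x a "c x"] insert.prems(1) by auto
  have "\<exists>z. [z = z0] (mod N * x) \<and> (\<forall>y\<in>S. [z = c y] (mod y))"
  proof (rule insert.IH)
    fix y assume "y \<in> S"
    with insert.hyps(2) have "coprime x y"
      by (intro insert.prems(2)) auto
    then show "coprime (N * x) y"
      using insert.prems(1) \<open>y \<in> S\<close> by simp
  qed (use insert.prems(2) in auto)
  then obtain z where z: "[z = z0] (mod N * x)" "\<forall>y\<in>S. [z = c y] (mod y)"
    by blast
  have "[z = z0] (mod N)" "[z = z0] (mod x)"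
    using z(1) by (auto elim: cong_dvd_modulus)
  then show ?case
    using z0 z(2) by (auto intro: cong_trans)
qed

section \<open>Growth of t b^t and exceptional values of t\<close>

text \<open>If \<open>X t\<^sub>3\<close> were nonnegative, its value at n = 1 would be at most
  \<open>P\<close>, and the one of \<open>t\<^sub>1\<close> smaller still. So all three
  \<open>X\<close> are negative and bounded below by \<alpha>, which leaves too little room for the
  growth of t b^t.\<close>

lemma no_three_small_values:
  fixes b \<alpha> \<beta> P :: int
  assumes "b \<ge> 3" and "P > 0"
    and t: "t\<^sub>1 < t\<^sub>2" "t\<^sub>2 < t\<^sub>3"
    and X: "X = (\<lambda>t. int t * b ^ t + \<alpha>)"
    and gaps: "X t\<^sub>1 + 2 * P < X t\<^sub>2" "X t\<^sub>2 + 2 * P < X t\<^sub>3"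
    and bad: "\<And>t. t \<in> {t\<^sub>1, t\<^sub>2, t\<^sub>3} \<Longrightarrow>
               P \<le> X t * b + \<beta> \<and> (\<exists>n\<ge>1. \<bar>X t * b ^ n + \<beta>\<bar> \<le> P)"
  shows False
proof -
  obtain n\<^sub>1 n\<^sub>2 n\<^sub>3 where n: "n\<^sub>1 \<ge> 1" "n\<^sub>2 \<ge> 1" "n\<^sub>3 \<ge> 1"
      "\<bar>X t\<^sub>1 * b ^ n\<^sub>1 + \<beta>\<bar> \<le> P" "\<bar>X t\<^sub>2 * b ^ n\<^sub>2 + \<beta>\<bar> \<le> P" "\<bar>X t\<^sub>3 * b ^ n\<^sub>3 + \<beta>\<bar> \<le> P"
    using bad by (metis insertCI)
  have neg: "X t\<^sub>3 < 0"
  proof (rule ccontr)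
    assume "\<not> X t\<^sub>3 < 0"
    moreover have "b \<le> b ^ n\<^sub>3"
      using \<open>b \<ge> 3\<close> n(3) self_le_power[of b n\<^sub>3] by simp
    ultimately have "X t\<^sub>3 * b \<le> X t\<^sub>3 * b ^ n\<^sub>3"
      by (intro mult_left_mono) auto
    then have "X t\<^sub>3 * b + \<beta> \<le> P"
      using n(6) by linarith
    moreover have "X t\<^sub>1 * b < X t\<^sub>3 * b"
      using gaps \<open>P > 0\<close> \<open>b \<ge> 3\<close> by (intro mult_strict_right_mono) auto
    ultimately show False
      using bad[of t\<^sub>1] by simp
  qed
  define Y where "Y t = - X t" for t
  have Y: "Y t\<^sub>2 + 2 * P < Y t\<^sub>1" "Y t\<^sub>3 + 2 * P < Y t\<^sub>2" "0 < Y t\<^sub>3"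
    using gaps neg by (auto simp: Y_def)
  \<comment> \<open>Both scaled values lie within \<open>P\<close> of \<beta>.\<close>
  have close: "\<bar>Y t\<^sub>1 * b ^ n\<^sub>1 - Y t\<^sub>2 * b ^ n\<^sub>2\<bar> \<le> 2 * P"
    using n(4,5) by (simp add: Y_def)
  \<comment> \<open>Distinct values that nearly agree after scaling by powers of \<open>b\<close> differ by a factor
    of at least about \<open>b\<close>, so \<open>t\<^sub>2 b^t\<^sub>2\<close> exceeds \<open>- \<alpha> / 3\<close> and \<open>t\<^sub>3 b^t\<^sub>3\<close> exceeds \<open>- \<alpha>\<close>.\<close>
  have "n\<^sub>1 < n\<^sub>2"
  proof (rule ccontr)
    assume "\<not> n\<^sub>1 < n\<^sub>2"
    then have "b ^ n\<^sub>2 \<le> b ^ n\<^sub>1"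
      using \<open>b \<ge> 3\<close> by (intro power_increasing) auto
    then have "Y t\<^sub>1 * b ^ n\<^sub>2 \<le> Y t\<^sub>1 * b ^ n\<^sub>1"
      using Y \<open>P > 0\<close> by (intro mult_left_mono) auto
    moreover have "(Y t\<^sub>1 - Y t\<^sub>2) * 1 \<le> (Y t\<^sub>1 - Y t\<^sub>2) * b ^ n\<^sub>2"
      using Y \<open>P > 0\<close> \<open>b \<ge> 3\<close> by (intro mult_left_mono) auto
    ultimately show False
      using close Y(1) by (simp add: algebra_simps)
  qed
  \<comment> \<open>Here b \<ge> 3 enters: one extra factor \<open>b\<close> gives
    \<open>b ^ n\<^sub>2 \<ge> 3 * b ^ n\<^sub>1\<close>.\<close>
  have "3 * Y t\<^sub>2 \<le> Y t\<^sub>1 + 2 * P"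
  proof (rule ccontr)
    assume less: "\<not> 3 * Y t\<^sub>2 \<le> Y t\<^sub>1 + 2 * P"
    have "b * b ^ n\<^sub>1 \<le> b ^ n\<^sub>2"
      using \<open>n\<^sub>1 < n\<^sub>2\<close> \<open>b \<ge> 3\<close> power_increasing[of "Suc n\<^sub>1" n\<^sub>2 b] by simp
    moreover have "3 * b ^ n\<^sub>1 \<le> b * b ^ n\<^sub>1"
      using \<open>b \<ge> 3\<close> by (intro mult_right_mono) auto
    ultimately have "Y t\<^sub>2 * (3 * b ^ n\<^sub>1) \<le> Y t\<^sub>2 * b ^ n\<^sub>2"
      using Y \<open>P > 0\<close> by (intro mult_left_mono) auto
    moreover have "(3 * Y t\<^sub>2 - Y t\<^sub>1) * 1 \<le> (3 * Y t\<^sub>2 - Y t\<^sub>1) * b ^ n\<^sub>1"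
      using less \<open>P > 0\<close> \<open>b \<ge> 3\<close> by (intro mult_left_mono) auto
    ultimately show False
      using close less by (simp add: algebra_simps)
  qed
  moreover have "Y t\<^sub>1 \<le> - \<alpha>"
    using \<open>b \<ge> 3\<close> by (simp add: Y_def X)
  \<comment> \<open>The error 2P is absorbed because
    \<open>2 * P < Y t\<^sub>1 \<le> - \<alpha>\<close>.\<close>
  ultimately have "- \<alpha> < 3 * (int t\<^sub>2 * b ^ t\<^sub>2)"
    using Y \<open>P > 0\<close> by (simp add: Y_def X)
  also have "\<dots> \<le> int t\<^sub>3 * (3 * b ^ t\<^sub>2)"
    using t \<open>b \<ge> 3\<close> by (simp add: mult_right_mono)
  also have "\<dots> \<le> int t\<^sub>3 * b ^ t\<^sub>3"
  proof (intro mult_left_mono)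
    have "3 * b ^ t\<^sub>2 \<le> b * b ^ t\<^sub>2"
      using \<open>b \<ge> 3\<close> by (intro mult_right_mono) auto
    also have "\<dots> \<le> b ^ t\<^sub>3"
      using t(2) \<open>b \<ge> 3\<close> power_increasing[of "Suc t\<^sub>2" t\<^sub>3 b] by simp
    finally show "3 * b ^ t\<^sub>2 \<le> b ^ t\<^sub>3" .
  qed auto
  finally show False
    using neg by (simp add: X)
qed

lemma strict_mono_times_power:
  fixes b :: int
  assumes "b \<ge> 1"
  shows "strict_mono (\<lambda>t::nat. int t * b ^ t)"
proof (rule strict_monoI)
  fix s t :: nat
  assume "s < t"
  have "int s * b ^ s < int t * b ^ s"
    using \<open>s < t\<close> assms by (intro mult_strict_right_mono) auto
  also have "\<dots> \<le> int t * b ^ t"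
    using \<open>s < t\<close> assms by (intro mult_left_mono power_increasing) auto
  finally show "int s * b ^ s < int t * b ^ t" .
qed

section \<open>Prescribing t b^t modulo many primes at once\<close>

lemma solve_linear_cong:
  fixes a k s p :: int
  assumes "coprime a p"
  shows "\<exists>x. [x * a = s] (mod p)"
proof -
  obtain y where "[a * y = 1] (mod p)"
    using cong_solve_coprime_int[OF assms] by blast
  then have "[s * y * a = s] (mod p)"
    using cong_scalar_left[of "a * y" 1 p s] by (simp add: ac_simps)
  then show ?thesis by blast
qed

text \<open>
  The prime \<open>q\<close> may itself be one of the \<open>p i\<close>. It has to be treated before the other
  primes, since their moduli \<open>m i\<close> may be divisible by \<open>q\<close>.
\<close>

lemma times_power_residue_class:
  fixes b u M W :: int and q :: nat and p c :: "'i \<Rightarrow> int"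
  assumes "finite I" and "inj_on p I" and "prime q" and "W > 0"
    and prime: "\<And>i. i \<in> I \<Longrightarrow> prime (p i)"
    and copb: "\<And>i. i \<in> I \<Longrightarrow> coprime b (p i)"
    and copW: "\<And>i. i \<in> I \<Longrightarrow> coprime W (p i)"
    and ord: "\<And>i. i \<in> I \<Longrightarrow> [b ^ m i = 1] (mod p i)"
    and mW: "\<And>i. i \<in> I \<Longrightarrow> int (m i) dvd W * int q"
    and mq: "\<And>i. i \<in> I \<Longrightarrow> p i = int q \<Longrightarrow> int (m i) dvd W"
    and mM: "\<And>i. i \<in> I \<Longrightarrow> int (m i) dvd M"
    and pM: "\<And>i. i \<in> I \<Longrightarrow> p i dvd M"
  shows "\<exists>T. [T = u] (mod W) \<and>
           (\<forall>t::nat. [int t = T] (mod M) \<longrightarrow> (\<forall>i\<in>I. [int t * b ^ t = c i] (mod p i)))"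
proof -
  have copb': "coprime (b ^ k) (p i)" if "i \<in> I" for i k
    using copb[OF that] by simp
  \<comment> \<open>The residue needed for t modulo \<open>p i\<close> once b^t is known to agree
    with \<open>b ^ k\<close> there.\<close>
  define x where "x i k = (SOME x. [x * b ^ k = c i] (mod p i))" for i and k :: nat
  have x: "[x i k * b ^ k = c i] (mod p i)" if "i \<in> I" for i k
    unfolding x_def using solve_linear_cong[OF copb'[OF that]] by (rule someI_ex)
  have q0: "int q > 0"
    using prime_gt_0_nat[OF \<open>prime q\<close>] by simp
  define s where "s = nat (u mod W)"
  have s: "[int s = u] (mod W)"
    using \<open>W > 0\<close> by (simp add: s_def)
  \<comment> \<open>If q is some \<open>p i\<close>, its order condition depends only on t modulo
    \<open>W\<close>, so the exponent \<open>s\<close> is already decisive. Otherwise no condition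
    modulo q is imposed here.\<close>
  have "\<exists>T\<^sub>1. [T\<^sub>1 = u] (mod W) \<and> (\<forall>i\<in>I. p i = int q \<longrightarrow> [T\<^sub>1 = x i s] (mod p i))"
  proof (cases "\<exists>i\<in>I. p i = int q")
    case True
    then obtain i where i: "i \<in> I" "p i = int q" by blast
    obtain z where z: "[z = u] (mod W)" "[z = x i s] (mod p i)"
      using binary_chinese_remainder_int[OF copW[OF i(1)]] by blast
    moreover have "j = i" if "j \<in> I" "p j = int q" for j
      using that i \<open>inj_on p I\<close> by (metis inj_onD)
    ultimately show ?thesis by blast
  next
    case False
    then show ?thesis by (auto intro: cong_refl)
  qed
  then obtain T\<^sub>1 where T1: "[T\<^sub>1 = u] (mod W)"
      "\<And>i. i \<in> I \<Longrightarrow> p i = int q \<Longrightarrow> [T\<^sub>1 = x i s] (mod p i)"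
    by blast
  \<comment> \<open>Fixing t modulo W q fixes b^t modulo every \<open>p i\<close>, so the remaining
    primes impose plain congruences on t.\<close>
  define k where "k = nat (T\<^sub>1 mod (W * int q))"
  have k: "[int k = T\<^sub>1] (mod W * int q)"
    using \<open>W > 0\<close> q0 by (simp add: k_def)
  define S where "S = p ` I - {int q}"
  \<comment> \<open>Targets are re-indexed by primes, as the Chinese remainder lemma expects;
    injectivity of \<open>p\<close> makes this sound.\<close>
  define c' where "c' y = x (the_inv_into I p y) k" for y
  have "coprime (W * int q) y" if "y \<in> S" for y
  proof -
    have "coprime (int q) y"
      using that prime \<open>prime q\<close> by (intro primes_coprime) (auto simp: S_def)
    then show ?thesis
      using that copW by (auto simp: S_def)
  qed
  moreover have "coprime y z" if "y \<in> S" "z \<in> S" "y \<noteq> z" for y z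
    using that prime by (intro primes_coprime) (auto simp: S_def)
  moreover have "finite S"
    using \<open>finite I\<close> by (simp add: S_def)
  ultimately obtain T where T: "[T = T\<^sub>1] (mod W * int q)" "\<And>y. y \<in> S \<Longrightarrow> [T = c' y] (mod y)"
    using chinese_remainder_int[of S "W * int q" T\<^sub>1 c'] by blast
  have TW: "[T = u] (mod W)"
    using cong_modulus_mult[OF T(1)] T1(1) by (rule cong_trans)
  have "[int t * b ^ t = c i] (mod p i)" if t: "[int t = T] (mod M)" and i: "i \<in> I" for t i
  proof -
    have tp: "[int t = T] (mod p i)" and tm: "[int t = T] (mod int (m i))"
      using t pM[OF i] mM[OF i] cong_dvd_modulus by blast+
    obtain l where l: "[T = x i l] (mod p i)" "[T = int l] (mod int (m i))"
    proof (cases "p i = int q")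
      case True
      have "[T = T\<^sub>1] (mod p i)"
        using T(1) True by (auto elim: cong_dvd_modulus)
      then have "[T = x i s] (mod p i)"
        using T1(2)[OF i True] by (rule cong_trans)
      moreover have "[T = int s] (mod int (m i))"
        using cong_trans[OF TW cong_sym[OF s]] mq[OF i True] by (rule cong_dvd_modulus)
      ultimately show ?thesis by (rule that)
    next
      case False
      then have "[T = x i k] (mod p i)"
        using T(2)[of "p i"] i \<open>inj_on p I\<close> by (simp add: S_def c'_def the_inv_into_f_f)
      moreover have "[T = int k] (mod int (m i))"
        using cong_trans[OF T(1) cong_sym[OF k]] mW[OF i] by (rule cong_dvd_modulus)
      ultimately show ?thesis by (rule that)
    qed
    have "[int t = x i l] (mod p i)"
      using tp l(1) by (rule cong_trans)
    moreover have "[b ^ t = b ^ l] (mod p i)"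
      using ord[OF i] cong_trans[OF tm l(2)] by (rule power_cong_of_exponent_cong)
    ultimately have "[int t * b ^ t = x i l * b ^ l] (mod p i)"
      by (rule cong_mult)
    then show ?thesis
      using x[OF i] by (rule cong_trans)
  qed
  then show ?thesis
    using TW by blast
qed

theorem theorem3p3:
  fixes b \<alpha> \<beta> M :: int and q :: nat
    and I :: "(nat \<times> nat \<times> nat) set"
    and r :: "nat \<times> nat \<times> nat \<Rightarrow> int"
    and m :: "nat \<times> nat \<times> nat \<Rightarrow> nat"
    and p :: "nat \<times> nat \<times> nat \<Rightarrow> int"
  assumes "b \<ge> 3" and "\<alpha> * \<beta> \<noteq> 0" and "prime q" and "q \<ge> 5"
    and "I = {0..q} \<times> {1..q} \<times> {0..1}"
    and "m = (\<lambda>(j, k, l). 2 ^ j * 3 ^ k * q ^ l)"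
    and "primitive_covering_system b I r m"
    and "primitive_prime_choice b I m p"
    and "M = Lcm ({2 ^ q, 3 ^ q, b - 1, int q} \<union> p ` I)"
  shows "\<exists>T::int. \<forall>t::nat.
           [int t = T] (mod M) \<and> (int t * b ^ t + \<alpha>) * b + \<beta> \<ge> Max (p ` I) \<longrightarrow>
             gcd (int t * b ^ t + \<alpha> + \<beta>) (b - 1) = 1 \<and>
             (\<forall>n::nat. n \<ge> 1 \<longrightarrow> composite_int ((int t * b ^ t + \<alpha>) * b ^ n + \<beta>))"
proof -

  \<comment> \<open>Sizes and coprimality of the moduli and primes\<close>
  have finI: "finite I" and inj: "inj_on p I"
    using assms by (auto simp: primitive_prime_choice_def)
  have ppd: "primitive_prime_divisor b (m i) (p i)" if "i \<in> I" for i
    using assms(8) that by (simp add: primitive_prime_choice_def)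
  have prime: "prime (p i)" if "i \<in> I" for i
    using ppd[OF that] by (simp add: primitive_prime_divisor_def)
  have m3: "m i \<ge> 3" if iI: "i \<in> I" for i
  proof -
    obtain j k l where i: "i = (j, k, l)" "k \<ge> 1"
      using iI assms(5) by auto
    have "3 ^ 1 \<le> (3::nat) ^ k"
      using i by (intro power_increasing) auto
    moreover have "1 \<le> 2 ^ j * q ^ l"
      using \<open>q \<ge> 5\<close> by simp
    ultimately have "1 * 3 \<le> (2 ^ j * q ^ l) * (3::nat) ^ k"
      by (intro mult_mono) auto
    then show ?thesis
      by (simp add: i assms(6) ac_simps)
  qed
  have pm: "int (m i) < p i" if "i \<in> I" for i
    using primitive_prime_divisor_gt[OF ppd[OF that]] m3[OF that] by simp
  have copb: "coprime b (p i)" if "i \<in> I" for i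
    using primitive_prime_divisor_coprime[OF ppd[OF that]] m3[OF that] by simp
  have ord: "[b ^ m i = 1] (mod p i)" if "i \<in> I" for i
    using ppd[OF that] by (simp add: primitive_prime_divisor_def cong_iff_dvd_diff)
  have cover: "\<exists>i\<in>I. [n = r i] (mod int (m i))" for n
    using assms(7) by (simp add: primitive_covering_system_def covering_system_def)

  \<comment> \<open>\<open>W\<close> is coprime to all \<open>p i\<close>, so the residue of T
    modulo \<open>W\<close> can be chosen freely. \<open>W\<close> is a product and need not divide
    \<open>M\<close>; only common divisors such as b - 1 transfer from T to t.\<close>
  define W where "W = 2 ^ q * 3 ^ q * (b - 1)"
  have copW: "coprime W (p i)" if i: "i \<in> I" for i
  proof -
    have "p i > 3"
      using pm[OF i] m3[OF i] by simp
    then have "coprime 2 (p i)" "coprime 3 (p i)"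
      using prime[OF i] by (intro primes_coprime; simp)+
    moreover have "\<not> p i dvd b ^ 1 - 1"
      using ppd[OF i] m3[OF i] unfolding primitive_prime_divisor_def
      by (metis le_refl less_le_trans one_less_numeral_iff semiring_norm(77))
    then have "coprime (b - 1) (p i)"
      using prime[OF i] by (metis power_one_right prime_imp_coprime coprime_commute)
    ultimately show ?thesis
      by (simp add: W_def)
  qed

  have dvd_M: "d dvd M" if "d \<in> {2 ^ q, 3 ^ q, b - 1, int q} \<union> p ` I" for d
    unfolding assms(9) using that by (rule dvd_Lcm)
  have m_dvd: "int (m (j, k, l)) dvd 2 ^ q * 3 ^ q * int q ^ l" if "(j, k, l) \<in> I" for j k l
    using that by (auto simp: assms(5,6) intro!: mult_dvd_mono le_imp_power_dvd)
  have m_dvd': "int (m i) dvd 2 ^ q * 3 ^ q * int q" if "i \<in> I" for i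
  proof -
    obtain j k l where i: "i = (j, k, l)" by (cases i)
    have "int q ^ l dvd int q ^ 1"
      using that i by (intro le_imp_power_dvd) (simp add: assms(5))
    then have "2 ^ q * 3 ^ q * int q ^ l dvd 2 ^ q * 3 ^ q * int q"
      by (intro mult_dvd_mono) auto
    then show ?thesis
      using m_dvd that unfolding i by (blast intro: dvd_trans)
  qed
  have mW: "int (m i) dvd W * int q" if "i \<in> I" for i
  proof -
    have "2 ^ q * 3 ^ q * int q dvd W * int q"
      by (auto simp: W_def)
    then show ?thesis
      using m_dvd'[OF that] by (rule dvd_trans[rotated])
  qed
  \<comment> \<open>The bound m_i < p_i = q excludes the factor q from m_i.\<close>
  have mq: "int (m i) dvd W" if "i \<in> I" "p i = int q" for i
  proof -
    obtain j k l where i: "i = (j, k, l)" by (cases i)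
    have "l = 0"
    proof (rule ccontr)
      assume "l \<noteq> 0"
      then have "q dvd m i"
        by (simp add: i assms(6))
      then have "q \<le> m i"
        using m3[OF that(1)] by (intro dvd_imp_le) auto
      then show False
        using pm[OF that(1)] that(2) by simp
    qed
    then have "int (m i) dvd 2 ^ q * 3 ^ q"
      using m_dvd[of j k l] that(1) i by simp
    then show ?thesis
      by (simp add: W_def)
  qed
  have mM: "int (m i) dvd M" if "i \<in> I" for i
  proof -
    have cop: "coprime (2 ^ q) (3 ^ q :: int)"
      by simp
    have "2 ^ q * 3 ^ q dvd M"
      by (intro divides_mult cop dvd_M) auto
    moreover have "coprime (2 ^ q * 3 ^ q) (int q)"
    proof -
      have "coprime 2 (int q)" "coprime 3 (int q)"
        using \<open>prime q\<close> \<open>q \<ge> 5\<close> by (intro primes_coprime; simp)+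
      then show ?thesis by simp
    qed
    ultimately have "2 ^ q * 3 ^ q * int q dvd M"
      by (intro divides_mult dvd_M) auto
    then show ?thesis
      using m_dvd'[OF that] by (rule dvd_trans[rotated])
  qed

  \<comment> \<open>Residue classes that force a prime factor\<close>
  define \<rho> where "\<rho> i = nat (r i mod int (m i))" for i
  have \<rho>: "[int (\<rho> i) = r i] (mod int (m i))" if "i \<in> I" for i
    using m3[OF that] by (simp add: \<rho>_def)
  \<comment> \<open>The residue of t b^t modulo \<open>p i\<close> that makes \<open>p i\<close>
    divide the term for every n in the i-th congruence class.\<close>
  define c where "c i = (SOME x. p i dvd (x + \<alpha>) * b ^ \<rho> i + \<beta>)" for i
  have c: "p i dvd (c i + \<alpha>) * b ^ \<rho> i + \<beta>" if i: "i \<in> I" for i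
  proof -
    have "coprime (b ^ \<rho> i) (p i)"
      using copb[OF i] by simp
    then obtain x where "[x * b ^ \<rho> i = - \<beta>] (mod p i)"
      using solve_linear_cong by blast
    then have "p i dvd ((x - \<alpha>) + \<alpha>) * b ^ \<rho> i + \<beta>"
      by (simp add: cong_iff_dvd_diff)
    then show ?thesis
      unfolding c_def by (rule someI)
  qed
  define good where "good t \<longleftrightarrow> (\<forall>i\<in>I. [int t * b ^ t = c i] (mod p i))" for t :: nat
  \<comment> \<open>The free parameter \<open>u\<close> later serves both the gcd condition and the
    separation of three classes.\<close>
  have "\<exists>T. [T = u] (mod W) \<and> (\<forall>t::nat. [int t = T] (mod M) \<longrightarrow> good t)" for u
    unfolding good_def using finI inj \<open>prime q\<close> _ prime copb copW ord mW mq mM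
    by (rule times_power_residue_class) (use \<open>b \<ge> 3\<close> dvd_M in \<open>auto simp: W_def\<close>)
  then obtain \<tau> where \<tau>: "\<And>u. [\<tau> u = u] (mod W)" "\<And>u t. [int t = \<tau> u] (mod M) \<Longrightarrow> good t"
    by metis

  \<comment> \<open>Gaps between good values and scarcity of bad ones\<close>
  define P where "P = Max (p ` I)"
  \<comment> \<open>Two indices guarantee a chosen prime other than the maximum
    \<open>P\<close>.\<close>
  have i01: "(0, 1, 0) \<in> I" "(1, 1, 0) \<in> I"
    using \<open>q \<ge> 5\<close> by (auto simp: assms(5))
  have PI: "P \<in> p ` I" and P_ge: "p i \<le> P" if "i \<in> I" for i
    using finI that i01 unfolding P_def by (auto intro!: Max_in)
  obtain i0 where i0: "i0 \<in> I" "P = p i0"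
    using PI[OF i01(1)] by blast
  obtain i1 where i1: "i1 \<in> I" "p i1 \<noteq> P"
    using i01 inj i0 by (metis Pair_inject inj_onD zero_neq_one)
  have P0: "P > 0"
    using prime_gt_0_int prime i0 by simp
  define X where "X = (\<lambda>t::nat. int t * b ^ t + \<alpha>)"
  have gap: "X s + 2 * P < X t" if "good s" "good t" "s < t" for s t
  proof -
    have "[X t = X s] (mod p i)" if "i \<in> I" for i
      using \<open>good s\<close> \<open>good t\<close> that unfolding good_def X_def
      by (intro cong_add cong_refl) (meson cong_sym cong_trans)
    then have dvd: "p i dvd X t - X s" if "i \<in> I" for i
      using that by (simp add: cong_iff_dvd_diff)
    have "coprime P (p i1)"
      using i0 i1 prime by (intro primes_coprime) auto
    then have "P * p i1 dvd X t - X s"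
      using dvd i0 i1 by (intro divides_mult) auto
    moreover have "X s < X t"
      using strict_monoD[OF strict_mono_times_power \<open>s < t\<close>, of b] \<open>b \<ge> 3\<close> by (simp add: X_def)
    \<comment> \<open>The second prime exceeds 3, which lifts the gap beyond 2P.\<close>
    ultimately have "P * p i1 \<le> X t - X s"
      by (simp add: zdvd_imp_le)
    moreover have "P * 2 < P * p i1"
      using P0 pm[OF i1(1)] m3[OF i1(1)] by (intro mult_strict_left_mono) auto
    ultimately show ?thesis by linarith
  qed
  \<comment> \<open>The size hypothesis holds, yet some term is too small for a prime factor to
    guarantee compositeness.\<close>
  define bad where "bad t \<longleftrightarrow> P \<le> X t * b + \<beta> \<and> (\<exists>n\<ge>1. \<bar>X t * b ^ n + \<beta>\<bar> \<le> P)" for t :: nat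
  have no_three: False
    if "s < t" "t < u" "good s" "good t" "good u" "bad s" "bad t" "bad u" for s t u
    by (rule no_three_small_values[OF \<open>b \<ge> 3\<close> P0 that(1,2) X_def])
       (use that gap in \<open>auto simp: bad_def\<close>)

  \<comment> \<open>Three distinct classes modulo M\<close>
  define a where "a = multiplicity 2 (b - 1)"
  obtain D where D: "b - 1 = 2 ^ a * D" "\<not> 2 dvd D"
    unfolding a_def using multiplicity_decompose'[of "b - 1" 2] \<open>b \<ge> 3\<close> by auto
  \<comment> \<open>\<open>D\<close> is the odd part of b - 1. Each \<open>v k\<close> is odd and
    congruent to 1 modulo \<open>D\<close>, hence coprime to b - 1.\<close>
  define v where "v k = 1 + 4 * k * D" for k
  have cop_v: "coprime (v k) (b - 1)" for k
  proof -
    have "coprime (v k) 2"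
      by (simp add: v_def)
    moreover have "coprime (v k) D"
      unfolding v_def by (metis coprime_1_left gcd_add_mult coprime_iff_gcd_eq_1 add.commute gcd.commute)
    ultimately show ?thesis
      by (simp add: D(1))
  qed
  \<comment> \<open>Modulo b - 1 the factor b^t is 1, so this shift yields
    \<open>X t + \<beta>\<close> congruent to \<open>v k\<close>.\<close>
  define T where "T k = \<tau> (v k - \<alpha> - \<beta>)" for k
  have T_inj: "\<not> [T k = T l] (mod M)" if "k \<in> {0, 1, 2}" "l \<in> {0, 1, 2}" "k < l" for k l
  proof
    assume "[T k = T l] (mod M)"
    moreover have "(2::int) ^ 5 dvd 2 ^ q"
      using \<open>q \<ge> 5\<close> by (intro le_imp_power_dvd)
    then have 32: "32 dvd W" "32 dvd M"
      using dvd_M[of "2 ^ q"] by (auto simp: W_def intro: dvd_trans)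
    ultimately have "[T k = T l] (mod 32)"
      using cong_dvd_modulus by blast
    moreover have "[T k = v k - \<alpha> - \<beta>] (mod 32)" for k
      using \<tau>(1) 32(1) unfolding T_def by (rule cong_dvd_modulus)
    ultimately have "[v k - \<alpha> - \<beta> = v l - \<alpha> - \<beta>] (mod 32)"
      by (meson cong_sym cong_trans)
    \<comment> \<open>Here k - l is -1 or -2 and \<open>D\<close> is odd, so not even 16 divides the
      right side.\<close>
    then have "32 dvd 4 * (k - l) * D"
      by (simp add: cong_iff_dvd_diff v_def algebra_simps)
    then show False
      using that D(2) by (auto; presburger)
  qed

  \<comment> \<open>Compositeness and the gcd condition\<close>
  have composite: "composite_int (X t * b ^ n + \<beta>)"
    if "good t" "\<not> bad t" "P \<le> X t * b + \<beta>" "n \<ge> 1" for t n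
  proof -
    obtain i where i: "i \<in> I" "[int n = r i] (mod int (m i))"
      using cover by blast
    have "[int n = int (\<rho> i)] (mod int (m i))"
      using i \<rho> by (meson cong_sym cong_trans)
    then have "[b ^ n = b ^ \<rho> i] (mod p i)"
      by (rule power_cong_of_exponent_cong[OF ord[OF i(1)]])
    then have "[X t * b ^ n + \<beta> = (c i + \<alpha>) * b ^ \<rho> i + \<beta>] (mod p i)"
      using \<open>good t\<close> i(1) unfolding good_def X_def by (intro cong_add cong_mult cong_refl) auto
    then have dvd: "p i dvd X t * b ^ n + \<beta>"
      using c[OF i(1)] cong_dvd_iff cong_sym by blast
    \<comment> \<open>Being neither bad nor below the size bound, t has every term beyond
      \<open>P\<close> in absolute value, so \<open>p i\<close> is a proper divisor.\<close>
    have "P < \<bar>X t * b ^ n + \<beta>\<bar>"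
      using that by (force simp: bad_def)
    then have "p i < \<bar>X t * b ^ n + \<beta>\<bar>"
      using P_ge[OF i(1)] by simp
    moreover have "p i > 1"
      using prime[OF i(1)] prime_gt_1_int by blast
    moreover have "\<not> prime \<bar>X t * b ^ n + \<beta>\<bar>"
      using dvd calculation by (auto simp: prime_int_iff intro!: exI[of _ "p i"])
    ultimately show ?thesis
      by (simp add: composite_int_def)
  qed
  have gcd: "gcd (X t + \<beta>) (b - 1) = 1" if "[int t = T k] (mod M)" for t k
  proof -
    have "[b = 1] (mod b - 1)"
      by (simp add: cong_iff_dvd_diff)
    then have "[b ^ t = 1] (mod b - 1)"
      using cong_pow by fastforce
    moreover have "[int t = T k] (mod b - 1)"
      using that dvd_M[of "b - 1"] cong_dvd_modulus by blast
    moreover have "[T k = v k - \<alpha> - \<beta>] (mod b - 1)"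
      unfolding T_def by (rule cong_dvd_modulus[OF \<tau>(1)]) (simp add: W_def)
    ultimately have "[int t * b ^ t = (v k - \<alpha> - \<beta>) * 1] (mod b - 1)"
      by (intro cong_mult) (auto intro: cong_trans)
    then have "[int t * b ^ t + (\<alpha> + \<beta>) = (v k - \<alpha> - \<beta>) * 1 + (\<alpha> + \<beta>)] (mod b - 1)"
      by (intro cong_add cong_refl)
    then have "[X t + \<beta> = v k] (mod b - 1)"
      by (simp add: X_def algebra_simps)
    then have "gcd (X t + \<beta>) (b - 1) = gcd (v k) (b - 1)"
      by (rule cong_gcd_eq)
    then show ?thesis
      using cop_v by simp
  qed

  \<comment> \<open>Choice of a class without bad values\<close>
  have "\<exists>k. \<forall>t. [int t = T k] (mod M) \<longrightarrow> \<not> bad t"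
  \<comment> \<open>Otherwise the classes for k = 0, 1, 2 would supply three distinct bad good
    values, contradicting \<open>no_three\<close> after sorting.\<close>
  proof (rule ccontr)
    assume "\<not> ?thesis"
    then obtain t where t: "\<And>k. [int (t k) = T k] (mod M)" "\<And>k. bad (t k)"
      by metis
    have good: "good (t k)" for k
      using t(1) unfolding T_def by (rule \<tau>(2))
    have "t k \<noteq> t l" if "k \<in> {0, 1, 2}" "l \<in> {0, 1, 2}" "k < l" for k l
      using T_inj[OF that] t(1) by (metis cong_sym cong_trans)
    then have "t 0 \<noteq> t 1" "t 0 \<noteq> t 2" "t 1 \<noteq> t 2"
      by auto
    then show False
      using no_three good t(2) by (metis nat_neq_iff)
  qed
  then obtain k where "\<And>t. [int t = T k] (mod M) \<Longrightarrow> \<not> bad t"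
    by blast
  then have "\<forall>t::nat. [int t = T k] (mod M) \<and> P \<le> X t * b + \<beta> \<longrightarrow>
      gcd (X t + \<beta>) (b - 1) = 1 \<and> (\<forall>n\<ge>1. composite_int (X t * b ^ n + \<beta>))"
    using composite gcd \<tau>(2) unfolding T_def by blast
  then show ?thesis
    unfolding X_def P_def by blast
qed

end
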